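(* Let $f:\mathbb{R}^n\to\mathbb{R}$ be a strictly convex, twice differentiable function that is bounded from below and attains its minimum at some $x^*\in\mathbb{R}^n$, and suppose $f$ is strongly self-concordant with constant $M>0$. Suppose the sequence $(x_k)_{k\in\mathbb{N}}$ in $\mathbb{R}^n$ is generated by Newton's method $$x_{k+1}=x_k-\frac{1}{1+\alpha_k}\nabla^2 f(x_k)^{-1}\nabla f(x_k),\qquad \alpha_k\ge 0.$$ Then for all $k\in\mathbb{N}$ the following hold: 1. If $\alpha_k=0$, then $$\lambda(x_{k+1})\le \frac{\sqrt{1+M\lambda(x_k)}}{2}\,M\lambda(x_k)^2 .$$ 2. If $\alpha_k=M\lambda(x_k)$, then $$\lambda(x_{k+1})\le \sqrt{\frac{1+2M\lambda(x_k)}{1+M\lambda(x_k)}}\;\frac{3+3M\lambda(x_k)}{2+3M\lambda(x_k)}\,M\lambda(x_k)^2\le \frac{3\sqrt2}{2}\,M\lambda(x_k)^2 .$$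
   Context: For symmetric matrices, $A\preceq B$ means $B-A$ is positive semidefinite. The local norm at $z\in\mathbb{R}^n$ is $\|y\|_z=(y^T\nabla^2 f(z)y)^{1/2}$. The function $f$ is strongly self-concordant with constant $M>0$ if for all $x,y,z,w\in\mathbb{R}^n$, $\nabla^2 f(y)-\nabla^2 f(x)\preceq M\|x-y\|_z\nabla^2 f(w)$. Hessians are taken to be invertible (positive definite), so that the local norms and their duals are well defined. The Newton decrement is $\lambda(x)=[\nabla f(x)^T\nabla^2 f(x)^{-1}\nabla f(x)]^{1/2}$. *)

theory Defs
  imports "HOL-Analysis.Analysis"
begin

definition gradient :: "(real^'n \<Rightarrow> real) \<Rightarrow> real^'n \<Rightarrow> real^'n" where
  "gradient f x = (THE D. GDERIV f x :> D)"

definition hessian :: "(real^'n \<Rightarrow> real) \<Rightarrow> real^'n \<Rightarrow> real^'n^'n" where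
  "hessian f x = jacobian (gradient f) (at x)"

(* Frechet differentiability of f and of its gradient on the whole space; continuity of the
   Hessian is not required. *)
definition twice_differentiable :: "(real^'n \<Rightarrow> real) \<Rightarrow> bool" where
  "twice_differentiable f \<longleftrightarrow>
     (\<forall>x. f differentiable at x) \<and> (\<forall>x. gradient f differentiable at x)"

lemma GDERIV_gradient:
  fixes f :: "real^'n \<Rightarrow> real"
  assumes "f differentiable at x"
  shows "GDERIV f x :> gradient f x"
proof -
  from assms obtain f' where f': "(f has_derivative f') (at x)"
    unfolding differentiable_def by blast
  have "linear f'"
    using f' by (rule has_derivative_linear)
  then have "f' h = h \<bullet> adjoint f' 1" for h
    using adjoint_works[of f' h 1] by simp
  then have "f' = (\<lambda>h. h \<bullet> adjoint f' 1)"
    by (rule ext)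
  then have D: "GDERIV f x :> adjoint f' 1"
    unfolding gderiv_def by (rule has_derivative_eq_rhs[OF f'])
  have "D' = adjoint f' 1" if "GDERIV f x :> D'" for D'
  proof -
    have "(\<lambda>h. h \<bullet> D') = (\<lambda>h. h \<bullet> adjoint f' 1)"
      using that D unfolding gderiv_def by (rule has_derivative_unique)
    then have "\<forall>h. h \<bullet> D' = h \<bullet> adjoint f' 1"
      by (intro allI) (rule fun_cong)
    then show ?thesis
      by (simp only: vector_eq_ldot)
  qed
  with D show ?thesis
    unfolding gradient_def by (rule theI)
qed

lemma has_derivative_hessian:
  fixes f :: "real^'n \<Rightarrow> real"
  assumes "gradient f differentiable at x"
  shows "(gradient f has_derivative (\<lambda>h. hessian f x *v h)) (at x)"
  using assms unfolding hessian_def by (simp add: jacobian_works)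

definition strictly_convex :: "('a::real_vector \<Rightarrow> real) \<Rightarrow> bool" where
  "strictly_convex f \<longleftrightarrow>
     (\<forall>x y t. x \<noteq> y \<longrightarrow> 0 < t \<longrightarrow> t < 1 \<longrightarrow>
        f ((1 - t) *\<^sub>R x + t *\<^sub>R y) < (1 - t) * f x + t * f y)"

definition pos_semidef :: "real^'n^'n \<Rightarrow> bool" where
  "pos_semidef A \<longleftrightarrow> transpose A = A \<and> (\<forall>v. 0 \<le> v \<bullet> (A *v v))"

definition pos_def :: "real^'n^'n \<Rightarrow> bool" where
  "pos_def A \<longleftrightarrow> transpose A = A \<and> (\<forall>v. v \<noteq> 0 \<longrightarrow> 0 < v \<bullet> (A *v v))"

(* The Loewner order; the library's componentwise \<le> on vectors and matrices is unrelated. *)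
definition loewner_le :: "real^'n^'n \<Rightarrow> real^'n^'n \<Rightarrow> bool" (infix "\<preceq>\<^sub>L" 50) where
  "A \<preceq>\<^sub>L B \<longleftrightarrow> pos_semidef (B - A)"

definition local_norm :: "(real^'n \<Rightarrow> real) \<Rightarrow> real^'n \<Rightarrow> real^'n \<Rightarrow> real" where
  "local_norm f z y = sqrt (y \<bullet> (hessian f z *v y))"

definition strongly_self_concordant :: "(real^'n \<Rightarrow> real) \<Rightarrow> real \<Rightarrow> bool" where
  "strongly_self_concordant f M \<longleftrightarrow>
     (\<forall>x y z w. hessian f y - hessian f x \<preceq>\<^sub>L (M * local_norm f z (x - y)) *\<^sub>R hessian f w)"

definition newton_decrement :: "(real^'n \<Rightarrow> real) \<Rightarrow> real^'n \<Rightarrow> real" where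
  "newton_decrement f x = sqrt (gradient f x \<bullet> (matrix_inv (hessian f x) *v gradient f x))"

end

theory Submission
  imports Defs
begin

text \<open>
  Write \<open>H\<close>, \<open>g\<close> and \<open>\<lambda>\<close> for the Hessian, the gradient and the Newton decrement at the current point,
  and measure everything in the norm of \<open>H\<close>. The Newton direction \<open>d = H\<inverse> g\<close> has length \<open>\<lambda>\<close>, so a
  step \<open>h = - s d\<close> with \<open>0 \<le> s \<le> 1\<close> has length \<open>s \<lambda>\<close>. Both cases of the theorem follow from a single
  estimate for such a damped step (\<open>newton_decrement_damped_step\<close>),
  \<open>\<lambda>\<^sub>+ \<le> sqrt (1 + M s \<lambda>) ((1 - s) \<lambda> + M (s \<lambda>)\<^sup>2 / 2)\<close>,
  with \<open>s = 1\<close> and \<open>s = 1 / (1 + M \<lambda>)\<close> respectively.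

  The three ingredients of the estimate match its three terms. After a fraction \<open>t\<close> of the step
  the Hessian has changed by at most \<open>M t s \<lambda> H\<close> in the Loewner order, so the error of the linear model \<open>g + H h\<close> of the new
  gradient has dual norm at most \<open>M (s \<lambda>)\<^sup>2 / 2\<close> (\<open>gradient_linearization_error\<close>). The linear model
  itself is \<open>(1 - s) g\<close>, of dual norm \<open>(1 - s) \<lambda>\<close>. Passing from the norm of the old Hessian to that of
  the new one costs the factor under the square root (\<open>local_norm_change\<close>).

  Dual norms are never introduced: with \<open>w\<close> the Newton direction at the new point, \<open>\<lambda>\<^sub>+\<^sup>2\<close> is the inner
  product of \<open>w\<close> with the new gradient, and \<open>\<lambda>\<^sub>+\<close> is the norm of \<open>w\<close>, so it is enough to bound the
  new gradient tested against a single vector. Testing also makes the gradient along the step a real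
  function, so that a monotonicity argument replaces the integral of the Hessian along the step in
  the estimate of the linearization error.
\<close>

section \<open>Positive definite forms\<close>

lemma pos_def_form_nonneg:
  fixes A :: "real^'n^'n"
  assumes "pos_def A"
  shows "0 \<le> v \<bullet> (A *v v)"
  using assms unfolding pos_def_def by (cases "v = 0") (auto intro: less_imp_le)

lemma pos_def_matrix_inv_apply:
  fixes A :: "real^'n^'n"
  assumes "pos_def A"
  shows "A *v (matrix_inv A *v y) = y"
proof -
  have "\<forall>v. A *v v = 0 \<longrightarrow> v = 0"
    using assms unfolding pos_def_def by (metis inner_zero_right less_irrefl)
  then have "invertible A"
    using invertible_left_inverse matrix_left_invertible_ker by blast
  then have "A ** matrix_inv A = mat 1"
    unfolding invertible_def matrix_inv_def by (rule someI_ex[THEN conjunct1])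
  then show ?thesis
    by (simp add: matrix_vector_mul_assoc)
qed

lemma symmetric_form_commute:
  fixes B :: "real^'n^'n"
  assumes "transpose B = B"
  shows "u \<bullet> (B *v v) = v \<bullet> (B *v u)"
  using assms by (metis dot_lmul_matrix inner_commute transpose_matrix_vector)

text \<open>
  Polarization turns the bound on the diagonal into \<open>v \<bullet> B h \<le> c\<close> for vectors of unit length, and
  homogeneity gives the general case. For \<open>B = A\<close> and \<open>c = 1\<close> this is the Cauchy--Schwarz inequality.
\<close>

lemma symmetric_form_le_of_diagonal:
  fixes A B :: "real^'n^'n"
  assumes A: "pos_def A" and B: "transpose B = B"
    and diag: "\<And>u. \<bar>u \<bullet> (B *v u)\<bar> \<le> c * (u \<bullet> (A *v u))"
  shows "v \<bullet> (B *v h) \<le> c * sqrt (v \<bullet> (A *v v)) * sqrt (h \<bullet> (A *v h))"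
proof (cases "v = 0 \<or> h = 0")
  case True
  then show ?thesis by auto
next
  case False
  define a where "a = sqrt (v \<bullet> (A *v v))"
  define b where "b = sqrt (h \<bullet> (A *v h))"
  have a: "a > 0" and b: "b > 0"
    using A False unfolding a_def b_def pos_def_def by auto
  have a2: "v \<bullet> (A *v v) = a\<^sup>2" and b2: "h \<bullet> (A *v h) = b\<^sup>2"
    using pos_def_form_nonneg[OF A] by (simp_all add: a_def b_def)
  have AT: "transpose A = A" using A by (simp add: pos_def_def)
  \<comment> \<open>The vectors \<open>b v\<close> and \<open>a h\<close> have the same length \<open>a b\<close>, which makes polarization sharp.\<close>
  define p where "p = b *\<^sub>R v + a *\<^sub>R h"
  define q where "q = b *\<^sub>R v - a *\<^sub>R h"
  have "4 * (a * b) * (v \<bullet> (B *v h)) = p \<bullet> (B *v p) - q \<bullet> (B *v q)"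
    using symmetric_form_commute[OF B, of h v] unfolding p_def q_def
    by (simp add: matrix_vector_right_distrib matrix_vector_mult_diff_distrib
        matrix_vector_mult_scaleR inner_simps algebra_simps)
  also have "\<dots> \<le> c * (p \<bullet> (A *v p)) + c * (q \<bullet> (A *v q))"
    using diag[of p] diag[of q] by linarith
  also have "\<dots> = 2 * c * (b\<^sup>2 * (v \<bullet> (A *v v)) + a\<^sup>2 * (h \<bullet> (A *v h)))"
    unfolding p_def q_def
    by (simp add: matrix_vector_right_distrib matrix_vector_mult_diff_distrib
        matrix_vector_mult_scaleR inner_simps algebra_simps power2_eq_square)
  also have "\<dots> = 4 * (a * b) * (c * a * b)"
    unfolding a2 b2 by (simp add: power2_eq_square)
  finally have "v \<bullet> (B *v h) \<le> c * a * b"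
    using a b by simp
  then show ?thesis by (simp add: a_def b_def)
qed

section \<open>Local norms and the Newton direction\<close>

lemma local_norm_nonneg:
  assumes "pos_def (hessian f z)"
  shows "0 \<le> local_norm f z y"
  using pos_def_form_nonneg[OF assms] by (simp add: local_norm_def)

lemma local_norm_power2:
  assumes "pos_def (hessian f z)"
  shows "(local_norm f z y)\<^sup>2 = y \<bullet> (hessian f z *v y)"
  using pos_def_form_nonneg[OF assms] by (simp add: local_norm_def)

lemma local_norm_scaleR:
  "local_norm f z (a *\<^sub>R y) = \<bar>a\<bar> * local_norm f z y"
proof -
  have "(a *\<^sub>R y) \<bullet> (hessian f z *v (a *\<^sub>R y)) = a\<^sup>2 * (y \<bullet> (hessian f z *v y))"
    by (simp add: matrix_vector_mult_scaleR power2_eq_square)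
  then show ?thesis by (simp add: local_norm_def real_sqrt_mult)
qed

lemma local_norm_minus: "local_norm f z (- y) = local_norm f z y"
  using local_norm_scaleR[of f z "-1" y] by simp

definition newton_direction :: "(real^'n \<Rightarrow> real) \<Rightarrow> real^'n \<Rightarrow> real^'n" where
  "newton_direction f z = matrix_inv (hessian f z) *v gradient f z"

lemma hessian_newton_direction:
  assumes "pos_def (hessian f z)"
  shows "hessian f z *v newton_direction f z = gradient f z"
  unfolding newton_direction_def by (rule pos_def_matrix_inv_apply[OF assms])

lemma newton_decrement_eq_local_norm:
  assumes "pos_def (hessian f z)"
  shows "newton_decrement f z = local_norm f z (newton_direction f z)"
  using hessian_newton_direction[OF assms]
  by (simp add: newton_decrement_def local_norm_def newton_direction_def inner_commute)

lemma newton_decrement_power2: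
  assumes "pos_def (hessian f z)"
  shows "(newton_decrement f z)\<^sup>2 = newton_direction f z \<bullet> gradient f z"
  using hessian_newton_direction[OF assms] local_norm_power2[OF assms]
  by (simp add: newton_decrement_eq_local_norm[OF assms])

text \<open>
  Since the gradient is the Hessian applied to the Newton direction, this is the Cauchy--Schwarz
  inequality in the local norm. It bounds the dual local norm of the gradient.
\<close>

lemma inner_gradient_le:
  assumes "pos_def (hessian f z)"
  shows "v \<bullet> gradient f z \<le> local_norm f z v * newton_decrement f z"
proof -
  have "v \<bullet> (hessian f z *v newton_direction f z)
      \<le> 1 * local_norm f z v * local_norm f z (newton_direction f z)"
    unfolding local_norm_def
  proof (rule symmetric_form_le_of_diagonal[OF assms])
    show "transpose (hessian f z) = hessian f z"
      using assms by (simp add: pos_def_def)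
    show "\<bar>u \<bullet> (hessian f z *v u)\<bar> \<le> 1 * (u \<bullet> (hessian f z *v u))" for u
      using pos_def_form_nonneg[OF assms, of u] by simp
  qed
  then show ?thesis
    by (simp add: hessian_newton_direction[OF assms] newton_decrement_eq_local_norm[OF assms])
qed

section \<open>Consequences of strong self-concordance\<close>

lemma strongly_self_concordant_form:
  assumes "strongly_self_concordant f M"
  shows "u \<bullet> (hessian f y *v u) - u \<bullet> (hessian f x *v u)
      \<le> M * local_norm f z (x - y) * (u \<bullet> (hessian f w *v u))"
proof -
  have "0 \<le> u \<bullet> (((M * local_norm f z (x - y)) *\<^sub>R hessian f w - (hessian f y - hessian f x)) *v u)"
    using assms unfolding strongly_self_concordant_def loewner_le_def pos_semidef_def by blast
  then show ?thesis
    by (simp add: matrix_vector_mult_diff_rdistrib scaleR_matrix_vector_assoc[symmetric]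
        inner_simps)
qed

lemma local_norm_change:
  assumes ssc: "strongly_self_concordant f M"
  shows "local_norm f x v \<le> sqrt (1 + M * local_norm f x (y - x)) * local_norm f y v"
proof -
  \<comment> \<open>The distance is measured at \<open>x\<close>, while the bounding Hessian is taken at \<open>y\<close>: strong
    self-concordance allows the two points to be chosen independently.\<close>
  have "v \<bullet> (hessian f x *v v) \<le> (1 + M * local_norm f x (y - x)) * (v \<bullet> (hessian f y *v v))"
    using strongly_self_concordant_form[OF ssc, of v x y x y] by (simp add: algebra_simps)
  then show ?thesis
    unfolding local_norm_def by (simp flip: real_sqrt_mult)
qed

lemma hessian_difference_bound:
  assumes pd: "\<forall>y. pos_def (hessian f y)" and ssc: "strongly_self_concordant f M"
  shows "v \<bullet> ((hessian f y - hessian f x) *v h)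
      \<le> M * local_norm f x (y - x) * local_norm f x v * local_norm f x h"
  unfolding local_norm_def[of f x v] local_norm_def[of f x h]
proof (rule symmetric_form_le_of_diagonal)
  show "pos_def (hessian f x)" using pd by blast
  show "transpose (hessian f y - hessian f x) = hessian f y - hessian f x"
    using pd by (simp add: pos_def_def transpose_def vec_eq_iff)
  fix u
  have "local_norm f x (x - y) = local_norm f x (y - x)"
    using local_norm_minus[of f x "y - x"] by simp
  then show "\<bar>u \<bullet> ((hessian f y - hessian f x) *v u)\<bar>
      \<le> M * local_norm f x (y - x) * (u \<bullet> (hessian f x *v u))"
    using strongly_self_concordant_form[OF ssc, of u x y x x]
      strongly_self_concordant_form[OF ssc, of u y x x x]
    by (simp add: matrix_vector_mult_diff_rdistrib inner_simps abs_le_iff)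
qed

text \<open>
  At the point \<open>x + t h\<close> the Hessian differs from the one at \<open>x\<close> by at most \<open>M t\<close> times the local norm
  of \<open>h\<close> times the Hessian at \<open>x\<close>. The factor \<open>1 / 2\<close> is the integral of \<open>t\<close> over the unit interval; it
  enters through the quadratic term \<open>C t\<^sup>2 / 2\<close> whose derivative compensates this growth.
\<close>

lemma gradient_linearization_error:
  fixes f :: "real^'n \<Rightarrow> real"
  assumes diff: "\<forall>y. gradient f differentiable at y"
    and pd: "\<forall>y. pos_def (hessian f y)" and ssc: "strongly_self_concordant f M"
  shows "v \<bullet> (gradient f (x + h) - gradient f x - hessian f x *v h)
      \<le> M * (local_norm f x h)\<^sup>2 / 2 * local_norm f x v"
proof -
  define C where "C = M * (local_norm f x h)\<^sup>2 * local_norm f x v"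
  define \<psi> where "\<psi> t = v \<bullet> (gradient f (x + t *\<^sub>R h) - t *\<^sub>R (hessian f x *v h)) - C * t\<^sup>2 / 2" for t
  have "\<psi> 1 \<le> \<psi> 0"
  proof (rule DERIV_nonpos_imp_nonincreasing[of 0 1 \<psi>])
    fix t :: real
    assume t: "0 \<le> t" "t \<le> 1"
    have line: "((\<lambda>t. x + t *\<^sub>R h) has_derivative (\<lambda>e. e *\<^sub>R h)) (at t)"
      by (auto intro!: derivative_eq_intros)
    have "((\<lambda>t. gradient f (x + t *\<^sub>R h)) has_derivative
        (\<lambda>e. hessian f (x + t *\<^sub>R h) *v (e *\<^sub>R h))) (at t)"
      using has_derivative_compose[OF line has_derivative_hessian] diff by blast
    then have grad: "((\<lambda>t. gradient f (x + t *\<^sub>R h)) has_vector_derivative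
        hessian f (x + t *\<^sub>R h) *v h) (at t)"
      by (simp add: has_vector_derivative_def matrix_vector_mult_scaleR)
    have "((\<lambda>t. v \<bullet> gradient f (x + t *\<^sub>R h)) has_real_derivative
        v \<bullet> (hessian f (x + t *\<^sub>R h) *v h)) (at t)"
      using bounded_linear.has_vector_derivative[OF bounded_linear_inner_right grad]
      by (simp add: has_real_derivative_iff_has_vector_derivative)
    then have "((\<lambda>t. v \<bullet> gradient f (x + t *\<^sub>R h) - t * (v \<bullet> (hessian f x *v h)) - C * t\<^sup>2 / 2)
        has_real_derivative
          v \<bullet> (hessian f (x + t *\<^sub>R h) *v h) - v \<bullet> (hessian f x *v h) - C * t) (at t)"
      by (auto intro!: derivative_eq_intros)
    then have deriv: "(\<psi> has_real_derivative
        v \<bullet> ((hessian f (x + t *\<^sub>R h) - hessian f x) *v h) - C * t) (at t)"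
      by (simp add: \<psi>_def[abs_def] inner_diff_right matrix_vector_mult_diff_rdistrib)
    have "v \<bullet> ((hessian f (x + t *\<^sub>R h) - hessian f x) *v h) \<le> C * t"
      using hessian_difference_bound[OF pd ssc, of v "x + t *\<^sub>R h" x h] t
      by (simp add: local_norm_scaleR C_def power2_eq_square algebra_simps)
    with deriv show "\<exists>y. (\<psi> has_real_derivative y) (at t) \<and> y \<le> 0"
      by (intro exI conjI) auto
  qed simp
  then show ?thesis
    by (simp add: \<psi>_def C_def inner_diff_right algebra_simps)
qed

section \<open>One damped Newton step\<close>

text \<open>
  The new gradient, tested against the new Newton direction \<open>w\<close>, is at most a constant times the old
  norm of \<open>w\<close>, hence at most a larger constant times the new norm of \<open>w\<close>. The inner product is the
  square of the new decrement and the new norm of \<open>w\<close> is the new decrement itself, so one factor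
  cancels.
\<close>

lemma newton_decrement_damped_step:
  fixes f :: "real^'n \<Rightarrow> real" and x :: "real^'n"
  assumes diff: "\<forall>y. gradient f differentiable at y"
    and pd: "\<forall>y. pos_def (hessian f y)" and ssc: "strongly_self_concordant f M"
    and M: "0 \<le> M" and s: "0 \<le> s" "s \<le> 1"
  defines "l \<equiv> newton_decrement f x"
  shows "newton_decrement f (x - s *\<^sub>R newton_direction f x)
      \<le> sqrt (1 + M * (s * l)) * ((1 - s) * l + M * (s * l)\<^sup>2 / 2)"
proof -
  define h where "h = - (s *\<^sub>R newton_direction f x)"
  define y where "y = x + h"
  define w where "w = newton_direction f y"
  define L where "L = newton_decrement f y"
  define K where "K = (1 - s) * l + M * (s * l)\<^sup>2 / 2"
  have pdx: "pos_def (hessian f x)" and pdy: "pos_def (hessian f y)"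
    using pd by blast+
  have l: "0 \<le> l" and L: "0 \<le> L"
    using local_norm_nonneg pdx pdy by (simp_all add: l_def L_def newton_decrement_eq_local_norm)
  have h_norm: "local_norm f x h = s * l"
    using s by (simp add: h_def local_norm_minus local_norm_scaleR l_def
        newton_decrement_eq_local_norm[OF pdx])
  have "hessian f x *v h = - (s *\<^sub>R gradient f x)"
    using matrix_vector_mult_scaleR[of "hessian f x" "-s" "newton_direction f x"]
    by (simp add: h_def hessian_newton_direction[OF pdx])
  then have "gradient f y = (1 - s) *\<^sub>R gradient f x
      + (gradient f (x + h) - gradient f x - hessian f x *v h)"
    by (simp add: y_def algebra_simps)
  then have "w \<bullet> gradient f y = (1 - s) * (w \<bullet> gradient f x)
      + w \<bullet> (gradient f (x + h) - gradient f x - hessian f x *v h)"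
    by (metis inner_add_right inner_scaleR_right)
  also have "\<dots> \<le> (1 - s) * (local_norm f x w * l) + M * (s * l)\<^sup>2 / 2 * local_norm f x w"
    using gradient_linearization_error[OF diff pd ssc, of w x h] inner_gradient_le[OF pdx, of w] s
    by (intro add_mono mult_left_mono) (simp_all add: h_norm l_def)
  also have "\<dots> = K * local_norm f x w"
    by (simp add: K_def algebra_simps)
  also have "\<dots> \<le> K * (sqrt (1 + M * (s * l)) * L)"
  proof (rule mult_left_mono)
    show "local_norm f x w \<le> sqrt (1 + M * (s * l)) * L"
      using local_norm_change[OF ssc, of x w y]
      by (simp add: y_def h_norm) (simp add: L_def w_def newton_decrement_eq_local_norm[OF pdy] flip: y_def)
    show "0 \<le> K" using M l s by (simp add: K_def)
  qed
  finally have "L * L \<le> (sqrt (1 + M * (s * l)) * K) * L"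
    using newton_decrement_power2[OF pdy] by (simp add: L_def w_def power2_eq_square mult_ac)
  moreover have "0 \<le> sqrt (1 + M * (s * l)) * K"
    using M l s by (simp add: K_def)
  ultimately have "L \<le> sqrt (1 + M * (s * l)) * K"
    using L by (cases "L = 0") auto
  then show ?thesis by (simp add: L_def y_def h_def K_def)
qed

text \<open>
  With \<open>u = M \<lambda>\<close> and \<open>s = 1 / (1 + u)\<close> the damped step estimate has the coefficient \<open>s + s\<^sup>2 / 2\<close> in front
  of \<open>M \<lambda>\<^sup>2\<close>. The bound on it is sharp at \<open>u = 0\<close>, where both are
  \<open>3 / 2\<close>.
\<close>

lemma damped_step_coefficient_le:
  fixes u :: real
  assumes "0 \<le> u"
  shows "1 / (1 + u) + 1 / (2 * (1 + u)\<^sup>2) \<le> (3 + 3 * u) / (2 + 3 * u)"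
proof -
  have "1 / (1 + u) + 1 / (2 * (1 + u)\<^sup>2) = (3 + 2 * u) / (2 * (1 + u)\<^sup>2)"
    using assms by (simp add: divide_simps power2_eq_square)
  also have "\<dots> \<le> (3 + 3 * u) / (2 + 3 * u)"
  proof -
    have "(3 + 3 * u) * (2 * (1 + u)\<^sup>2) - (3 + 2 * u) * (2 + 3 * u) = 5 * u + 12 * u\<^sup>2 + 6 * u ^ 3"
      by (simp add: power2_eq_square power3_eq_cube algebra_simps)
    moreover have "0 \<le> 5 * u + 12 * u\<^sup>2 + 6 * u ^ 3" using assms by simp
    ultimately have "(3 + 2 * u) * (2 + 3 * u) \<le> (3 + 3 * u) * (2 * (1 + u)\<^sup>2)" by linarith
    then show ?thesis
      using assms by (simp add: divide_simps)
  qed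
  finally show ?thesis .
qed

lemma damped_step_coefficient_le_const:
  fixes u :: real
  assumes "0 \<le> u"
  shows "sqrt ((1 + 2 * u) / (1 + u)) * ((3 + 3 * u) / (2 + 3 * u)) \<le> 3 * sqrt 2 / 2"
proof -
  have "sqrt ((1 + 2 * u) / (1 + u)) * ((3 + 3 * u) / (2 + 3 * u)) \<le> sqrt 2 * (3 / 2)"
    using assms by (intro mult_mono) (auto simp: divide_simps)
  then show ?thesis by simp
qed

theorem theorem3p1:
  fixes f :: "real^'n \<Rightarrow> real" and M :: real
    and xstar :: "real^'n"
    and x :: "nat \<Rightarrow> real^'n" and \<alpha> :: "nat \<Rightarrow> real"
  assumes "strictly_convex f"
    and "twice_differentiable f"
    and "\<forall>y. pos_def (hessian f y)"
    and "bdd_below (range f)"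
    and "\<forall>y. f xstar \<le> f y"
    and "M > 0"
    and "strongly_self_concordant f M"
    and "\<forall>k. \<alpha> k \<ge> 0"
    and "\<forall>k. x (Suc k) = x k - (1 / (1 + \<alpha> k)) *\<^sub>R (matrix_inv (hessian f (x k)) *v gradient f (x k))"
  shows "\<forall>k.
      (\<alpha> k = 0 \<longrightarrow>
        newton_decrement f (x (Suc k))
          \<le> sqrt (1 + M * newton_decrement f (x k)) / 2 * M * (newton_decrement f (x k))\<^sup>2)
    \<and> (\<alpha> k = M * newton_decrement f (x k) \<longrightarrow>
        newton_decrement f (x (Suc k))
          \<le> sqrt ((1 + 2 * M * newton_decrement f (x k)) / (1 + M * newton_decrement f (x k)))
            * ((3 + 3 * M * newton_decrement f (x k)) / (2 + 3 * M * newton_decrement f (x k)))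
            * M * (newton_decrement f (x k))\<^sup>2
      \<and> sqrt ((1 + 2 * M * newton_decrement f (x k)) / (1 + M * newton_decrement f (x k)))
            * ((3 + 3 * M * newton_decrement f (x k)) / (2 + 3 * M * newton_decrement f (x k)))
            * M * (newton_decrement f (x k))\<^sup>2
          \<le> 3 * sqrt 2 / 2 * M * (newton_decrement f (x k))\<^sup>2)"
proof (rule allI, intro conjI impI)
  fix k
  define l where "l = newton_decrement f (x k)"
  have diff: "\<forall>y. gradient f differentiable at y"
    using assms(2) by (simp add: twice_differentiable_def)
  note pd = assms(3) and M = assms(6) and ssc = assms(7)
  have l: "0 \<le> l"
    using pd by (simp add: l_def newton_decrement_eq_local_norm local_norm_nonneg)
  define u where "u = M * l"
  have u: "0 \<le> u" using M l by (simp add: u_def)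
  define s where "s = 1 / (1 + \<alpha> k)"
  have s: "0 \<le> s" "s \<le> 1"
    using assms(8) by (simp_all add: s_def add_pos_nonneg)
  have "x (Suc k) = x k - s *\<^sub>R newton_direction f (x k)"
    using assms(9) by (simp add: s_def newton_direction_def)
  then have step: "newton_decrement f (x (Suc k))
      \<le> sqrt (1 + M * (s * l)) * ((1 - s) * l + M * (s * l)\<^sup>2 / 2)"
    using newton_decrement_damped_step[OF diff pd ssc _ s, of "x k"] M by (simp add: l_def)
  show "newton_decrement f (x (Suc k))
      \<le> sqrt (1 + M * newton_decrement f (x k)) / 2 * M * (newton_decrement f (x k))\<^sup>2"
    if "\<alpha> k = 0"
    using step that by (simp add: s_def l_def mult_ac)
  show "newton_decrement f (x (Suc k))
      \<le> sqrt ((1 + 2 * M * newton_decrement f (x k)) / (1 + M * newton_decrement f (x k)))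
        * ((3 + 3 * M * newton_decrement f (x k)) / (2 + 3 * M * newton_decrement f (x k)))
        * M * (newton_decrement f (x k))\<^sup>2"
    if "\<alpha> k = M * newton_decrement f (x k)"
  proof -
    have su: "s = 1 / (1 + u)" using that by (simp add: s_def u_def l_def)
    have root: "1 + M * (s * l) = (1 + 2 * u) / (1 + u)"
      using u by (simp add: su field_simps) (simp add: u_def)
    have "1 - s = u * s"
      using u by (simp add: su field_simps)
    then have "(1 - s) * l + M * (s * l)\<^sup>2 / 2 = (u * s) * l + M * (s * l)\<^sup>2 / 2"
      by simp
    also have "\<dots> = (s + s\<^sup>2 / 2) * (M * l\<^sup>2)"
      by (simp add: u_def power2_eq_square algebra_simps)
    also have "\<dots> = (1 / (1 + u) + 1 / (2 * (1 + u)\<^sup>2)) * (M * l\<^sup>2)"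
      by (simp add: su power_divide)
    also have "\<dots> \<le> (3 + 3 * u) / (2 + 3 * u) * (M * l\<^sup>2)"
      using damped_step_coefficient_le[OF u] M by (intro mult_right_mono) auto
    finally have "sqrt (1 + M * (s * l)) * ((1 - s) * l + M * (s * l)\<^sup>2 / 2)
        \<le> sqrt ((1 + 2 * u) / (1 + u)) * ((3 + 3 * u) / (2 + 3 * u) * (M * l\<^sup>2))"
      unfolding root using u by (intro mult_left_mono) auto
    with step show ?thesis by (simp add: u_def l_def mult.assoc)
  qed
  show "sqrt ((1 + 2 * M * newton_decrement f (x k)) / (1 + M * newton_decrement f (x k)))
        * ((3 + 3 * M * newton_decrement f (x k)) / (2 + 3 * M * newton_decrement f (x k)))
        * M * (newton_decrement f (x k))\<^sup>2
      \<le> 3 * sqrt 2 / 2 * M * (newton_decrement f (x k))\<^sup>2"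
    using mult_right_mono[OF damped_step_coefficient_le_const[OF u], of "M * l\<^sup>2"] M
    by (simp add: u_def l_def mult.assoc)
qed

end
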